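(* For all positive integers $n$ and $k$, the number of permutations in $s^{-1}(\mathrm{Av}_n(132,312))$ that have exactly $k-1$ descents is $\mathrm{BoNa}(n,k)$.
   Context: A binary plane tree is a rooted plane tree on unlabeled vertices in which every non-leaf vertex has one or two children, and every child is a left child or a right child, even if it is the only child of its parent. A 0-1-tree is a binary plane tree in which every vertex that has two children is labeled 0 or 1 (no other vertex is labeled). A right edge is an edge connecting a vertex to its right child. For $n\ge 1$, the Boolean-Narayana number $\mathrm{BoNa}(n,k)$ is the number of 0-1-trees on $n$ vertices that have exactly $k-1$ right edges. The stack sorting operation $s$ is defined recursively on finite strings of distinct positive integers (permutations and their substrings): $s$ of the empty string is empty, $s$ of a one-element string is itself, and if $p=LmR$ where $m$ is the maximum entry of $p$, $L$ is the (possibly empty) substring of entries to the left of $m$ and $R$ the (possibly empty) substring of entries to the right of $m$, then $s(p)=s(L)\,s(R)\,m$. A permutation $p=p_1p_2\cdots p_n$ contains the pattern $q=q_1\cdots q_k$ if there are indices $i_1<\cdots<i_k$ such that $p_{i_a}<p_{i_b}$ if and only if $q_a<q_b$; otherwise $p$ avoids $q$. $\mathrm{Av}_n(q,q')$ is the set of permutations of length $n$ that avoid both $q$ and $q'$, and $s^{-1}(\mathrm{Av}_n(q,q'))$ is the set of permutations $p$ of length $n$ such that $s(p)\in \mathrm{Av}_n(q,q')$. An index $i$ with $1\le i\le n-1$ is a descent of $p$ if $p_i>p_{i+1}$. *)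

theory Defs
  imports Complex_Main "HOL-Combinatorics.Multiset_Permutations"
begin

text \<open>
  Permutations of length \<open>n\<close> are written in one-line notation, as elements of
  \<open>permutations_of_set {1..n}\<close>, i.e. distinct lists with set of entries \<open>{1..n}\<close>.
  List positions start at 0.
\<close>

datatype zo_label = Label0 | Label1

text \<open>
  The constructors give the possible shapes at the root: no child, only a left child,
  only a right child, or both; only in the last case is the root labelled.
  There is no empty tree.
\<close>

datatype zo_tree =
    Leaf
  | Only_Left zo_tree
  | Only_Right zo_tree
  | Both zo_label zo_tree zo_tree

primrec vertices :: "zo_tree \<Rightarrow> nat" where
  "vertices Leaf = 1"
| "vertices (Only_Left l) = 1 + vertices l"
| "vertices (Only_Right r) = 1 + vertices r"
| "vertices (Both c l r) = 1 + vertices l + vertices r"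

primrec right_edges :: "zo_tree \<Rightarrow> nat" where
  "right_edges Leaf = 0"
| "right_edges (Only_Left l) = right_edges l"
| "right_edges (Only_Right r) = 1 + right_edges r"
| "right_edges (Both c l r) = 1 + right_edges l + right_edges r"

text \<open>Only meaningful for \<open>n \<ge> 1\<close> and \<open>k \<ge> 1\<close>; at \<open>k = 0\<close> the subtraction truncates.\<close>

definition BoNa :: "nat \<Rightarrow> nat \<Rightarrow> nat" where
  "BoNa n k = card {t. vertices t = n \<and> right_edges t = k - 1}"

lemma finite_zo_trees: "finite {t. vertices t \<le> n}"
proof (induction n)
  case 0
  have "vertices t \<noteq> 0" for t by (cases t) auto
  then have "{t. vertices t \<le> 0} = {}" by simp
  then show ?case by (simp only: finite.emptyI)
next
  case (Suc n)
  let ?T = "{t. vertices t \<le> n}"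
  have labels: "(UNIV :: zo_label set) = {Label0, Label1}"
    using zo_label.exhaust by auto
  have "finite ({Leaf} \<union> Only_Left ` ?T \<union> Only_Right ` ?T
          \<union> (\<lambda>(c, l, r). Both c l r) ` (UNIV \<times> ?T \<times> ?T))"
    using Suc by (simp add: labels)
  moreover have "{t. vertices t \<le> Suc n} \<subseteq> {Leaf} \<union> Only_Left ` ?T \<union> Only_Right ` ?T
          \<union> (\<lambda>(c, l, r). Both c l r) ` (UNIV \<times> ?T \<times> ?T)"
  proof
    fix t assume "t \<in> {t. vertices t \<le> Suc n}"
    then show "t \<in> {Leaf} \<union> Only_Left ` ?T \<union> Only_Right ` ?T
          \<union> (\<lambda>(c, l, r). Both c l r) ` (UNIV \<times> ?T \<times> ?T)"
      by (cases t) (auto simp: image_iff)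
  qed
  ultimately show ?case by (rule finite_subset[rotated])
qed

text \<open>
  With \<open>m\<close> the maximum entry of \<open>p\<close>, the lists \<open>L\<close> and \<open>R\<close> are the entries before and after
  (the first occurrence of) \<open>m\<close>, so that \<open>p = L @ m # R\<close>.
\<close>

function stack_sort :: "nat list \<Rightarrow> nat list" where
  "stack_sort p =
     (if p = [] then []
      else let m = Max (set p);
               L = takeWhile (\<lambda>x. x \<noteq> m) p;
               R = tl (dropWhile (\<lambda>x. x \<noteq> m) p)
           in stack_sort L @ stack_sort R @ [m])"
  by pat_completeness auto
termination
proof (relation "measure length", goal_cases)
  case 1
  show ?case by simp
next
  case (2 p m L)
  then have "m \<in> set p" by simp
  then have "length (takeWhile (\<lambda>x. x \<noteq> m) p) < length p"
    by (induction p) auto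
  with 2 show ?case by simp
next
  case (3 p m L R)
  then show ?case
    using length_dropWhile_le[of "\<lambda>x. x \<noteq> m" p] by (cases p) auto
qed

declare stack_sort.simps [simp del]

lemma stack_sort_Nil: "stack_sort [] = []"
  by (simp add: stack_sort.simps)

lemma stack_sort_LmR:
  assumes "\<And>x. x \<in> set L \<union> set R \<Longrightarrow> x < m"
  shows "stack_sort (L @ m # R) = stack_sort L @ stack_sort R @ [m]"
proof -
  have "Max (set (L @ m # R)) = m"
    by (rule Max_eqI) (use assms in \<open>auto intro: less_imp_le\<close>)
  moreover have "takeWhile (\<lambda>x. x \<noteq> m) (L @ m # R) = L"
    "dropWhile (\<lambda>x. x \<noteq> m) (L @ m # R) = m # R"
    using assms by (auto simp: takeWhile_append dropWhile_append)
  ultimately show ?thesis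
    by (subst stack_sort.simps) (simp add: Let_def)
qed

text \<open>The map \<open>\<iota>\<close> is the choice of positions \<open>i\<^sub>1 < \<dots> < i\<^sub>k\<close> of the occurrence of \<open>q\<close> in \<open>p\<close>.\<close>

definition contains_pattern :: "nat list \<Rightarrow> nat list \<Rightarrow> bool" where
  "contains_pattern p q \<longleftrightarrow>
     (\<exists>\<iota>. strict_mono_on {..<length q} \<iota> \<and>
          (\<forall>a<length q. \<iota> a < length p) \<and>
          (\<forall>a<length q. \<forall>b<length q. p ! \<iota> a < p ! \<iota> b \<longleftrightarrow> q ! a < q ! b))"

definition Av :: "nat \<Rightarrow> nat list \<Rightarrow> nat list \<Rightarrow> nat list set" where
  "Av n q q' = {p \<in> permutations_of_set {1..n}.
     \<not> contains_pattern p q \<and> \<not> contains_pattern p q'}"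

definition stack_sort_preimage_Av :: "nat \<Rightarrow> nat list \<Rightarrow> nat list \<Rightarrow> nat list set" where
  "stack_sort_preimage_Av n q q' =
     {p \<in> permutations_of_set {1..n}. stack_sort p \<in> Av n q q'}"

definition descents :: "nat list \<Rightarrow> nat set" where
  "descents p = {i. Suc i < length p \<and> p ! i > p ! Suc i}"

end

theory Submission
  imports Defs
begin

text \<open>
  A list avoids both 132 and 312 iff each entry is larger than all previous ones or smaller than
  all previous ones. Write \<open>p = L m R\<close> with \<open>m\<close> maximal, so that \<open>s(p) = s(L) s(R) m\<close>. If \<open>L\<close> and
  \<open>R\<close> are non-empty, then \<open>s(p)\<close> has this property iff \<open>s(L)\<close> and \<open>s(R)\<close> do and the values of \<open>L\<close>
  form an interval adjacent to the first entry \<open>f\<close> of \<open>s(R)\<close>. Given the relative orders in \<open>L\<close> and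
  \<open>R\<close>, this leaves exactly two possibilities, just below \<open>f\<close> or just above \<open>f\<close>; they correspond to
  the two labels of a vertex with two children. Since \<open>p\<close> has one descent more than \<open>L\<close> and \<open>R\<close>
  together iff \<open>R\<close> is non-empty, descents correspond to right edges.
\<close>

section \<open>Lists built from successive new maxima and minima\<close>

text \<open>\<open>S\<close> holds the entries that came earlier, so a concatenation is handled by
  enlarging \<open>S\<close>; in \<open>s(L) s(R) m\<close>, the list \<open>s(R)\<close> is tested
  against \<open>set L\<close>.\<close>

primrec extremal :: "nat set \<Rightarrow> nat list \<Rightarrow> bool" where
  "extremal S [] \<longleftrightarrow> True"
| "extremal S (x # xs) \<longleftrightarrow>
     ((\<forall>y\<in>S. y < x) \<or> (\<forall>y\<in>S. x < y)) \<and> extremal (insert x S) xs"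

lemma extremal_append:
  "extremal S (xs @ ys) \<longleftrightarrow> extremal S xs \<and> extremal (S \<union> set xs) ys"
  by (induction xs arbitrary: S) auto

lemma extremal_mono: "extremal S xs \<Longrightarrow> T \<subseteq> S \<Longrightarrow> extremal T xs"
proof (induction xs arbitrary: S T)
  case (Cons x xs)
  have "extremal (insert x T) xs"
    by (rule Cons.IH[of "insert x S"]) (use Cons.prems in auto)
  moreover have "(\<forall>y\<in>T. y < x) \<or> (\<forall>y\<in>T. x < y)"
    using Cons.prems by (meson extremal.simps(2) subsetD)
  ultimately show ?case by simp
qed simp

text \<open>The set of earlier entries only grows along the list, so every test includes all of
  \<open>S\<close>.\<close>

lemma extremal_member:
  "extremal S xs \<Longrightarrow> x \<in> set xs \<Longrightarrow> (\<forall>y\<in>S. y < x) \<or> (\<forall>y\<in>S. x < y)"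
proof (induction xs arbitrary: S)
  case (Cons z xs)
  show ?case
  proof (cases "x = z")
    case False
    with Cons.prems have "(\<forall>y\<in>insert z S. y < x) \<or> (\<forall>y\<in>insert z S. x < y)"
      by (intro Cons.IH) auto
    then show ?thesis by blast
  qed (use Cons.prems in simp)
qed simp

lemma extremal_map:
  assumes "strict_mono_on (S \<union> set xs) h"
  shows "extremal (h ` S) (map h xs) \<longleftrightarrow> extremal S xs"
  using assms
proof (induction xs arbitrary: S)
  case (Cons x xs)
  have "extremal (h ` insert x S) (map h xs) \<longleftrightarrow> extremal (insert x S) xs"
    using Cons.prems by (intro Cons.IH) simp
  moreover have "h y < h x \<longleftrightarrow> y < x" "h x < h y \<longleftrightarrow> x < y" if "y \<in> S" for y
    using that by (simp_all add: strict_mono_on_less[OF Cons.prems])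
  ultimately show ?case by simp
qed simp

text \<open>An element common to \<open>S\<close> and \<open>S'\<close> fixes the side:
  \<open>x\<close> lies on the same side of \<open>S'\<close> as of that element, hence as of
  \<open>T\<close>. The set \<open>T\<close> serves the induction and absorbs the entries already
  passed.\<close>

lemma extremal_enlarge:
  assumes "extremal (T \<union> S) xs" and "S \<noteq> {}" and "S \<subseteq> S'"
    and "\<And>x. x \<in> set xs \<Longrightarrow> (\<forall>y\<in>S'. y < x) \<or> (\<forall>y\<in>S'. x < y)"
  shows "extremal (T \<union> S') xs"
  using assms
proof (induction xs arbitrary: T)
  case (Cons x xs)
  have "extremal (insert x T \<union> S') xs"
  proof (rule Cons.IH)
    show "extremal (insert x T \<union> S) xs" using Cons.prems(1) by simp
    show "(\<forall>z\<in>S'. z < y) \<or> (\<forall>z\<in>S'. y < z)" if "y \<in> set xs" for y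
      using that by (intro Cons.prems(4)) simp
  qed (fact Cons.prems)+
  moreover have "(\<forall>y\<in>T \<union> S'. y < x) \<or> (\<forall>y\<in>T \<union> S'. x < y)"
  proof -
    obtain s where s: "s \<in> S" "s \<in> S'"
      using Cons.prems(2,3) by blast
    have S': "(\<forall>y\<in>S'. y < x) \<or> (\<forall>y\<in>S'. x < y)"
      by (rule Cons.prems(4)) simp
    from Cons.prems(1) consider "\<forall>y\<in>T \<union> S. y < x" | "\<forall>y\<in>T \<union> S. x < y"
      by (meson extremal.simps(2))
    then show ?thesis
    proof cases
      case 1
      with s have "\<not> x < s" by (blast dest: less_asym)
      with 1 S' s(2) show ?thesis by blast
    next
      case 2
      with s have "\<not> s < x" by (blast dest: less_asym)
      with 2 S' s(2) show ?thesis by blast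
    qed
  qed
  ultimately show ?case by simp
qed simp

lemma extremal_iff_nth:
  "extremal {} xs \<longleftrightarrow>
     (\<forall>k<length xs. (\<forall>i<k. xs ! i < xs ! k) \<or> (\<forall>i<k. xs ! k < xs ! i))"
proof (induction xs rule: rev_induct)
  case (snoc x xs)
  have "(\<forall>k<length (xs @ [x]). (\<forall>i<k. (xs @ [x]) ! i < (xs @ [x]) ! k)
           \<or> (\<forall>i<k. (xs @ [x]) ! k < (xs @ [x]) ! i))
     \<longleftrightarrow> (\<forall>k<length xs. (\<forall>i<k. xs ! i < xs ! k) \<or> (\<forall>i<k. xs ! k < xs ! i))
       \<and> ((\<forall>i<length xs. xs ! i < x) \<or> (\<forall>i<length xs. x < xs ! i))"
    by (auto simp: less_Suc_eq nth_append)
  then show ?case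
    unfolding snoc.IH[symmetric] by (simp add: extremal_append all_set_conv_all_nth)
qed simp

section \<open>Avoidance of 132 and 312\<close>

lemma all_less_3: "(\<forall>a<length [x, y, z]. P a) \<longleftrightarrow> P 0 \<and> P 1 \<and> P 2"
  by (auto simp: less_Suc_eq numeral_2_eq_2)

text \<open>A choice of positions for a pattern of length 3 amounts to three increasing indices;
  conversely, the list \<open>[i, j, k]\<close> read through \<open>(!)\<close> serves as the choice
  function.\<close>

lemma contains_pattern_3:
  "contains_pattern p [x, y, z] \<longleftrightarrow>
     (\<exists>i j k. i < j \<and> j < k \<and> k < length p \<and>
        (\<forall>a<length [x, y, z]. \<forall>b<length [x, y, z].
           p ! ([i, j, k] ! a) < p ! ([i, j, k] ! b) \<longleftrightarrow> [x, y, z] ! a < [x, y, z] ! b))"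
    (is "?L \<longleftrightarrow> ?R")
proof
  assume ?L
  then obtain \<iota> where \<iota>: "strict_mono_on {..<length [x, y, z]} \<iota>"
    "\<forall>a<length [x, y, z]. \<iota> a < length p"
    "\<forall>a<length [x, y, z]. \<forall>b<length [x, y, z].
       p ! \<iota> a < p ! \<iota> b \<longleftrightarrow> [x, y, z] ! a < [x, y, z] ! b"
    unfolding contains_pattern_def by blast
  have "\<iota> 0 < \<iota> 1" "\<iota> 1 < \<iota> 2"
    by (rule strict_mono_onD[OF \<iota>(1)]; simp)+
  with \<iota>(2,3) show ?R
    unfolding all_less_3 by (intro exI[of _ "\<iota> 0"] exI[of _ "\<iota> 1"] exI[of _ "\<iota> 2"]) simp
next
  assume ?R
  then obtain i j k where ijk: "i < j" "j < k" "k < length p"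
    and order: "\<forall>a<length [x, y, z]. \<forall>b<length [x, y, z].
           p ! ([i, j, k] ! a) < p ! ([i, j, k] ! b) \<longleftrightarrow> [x, y, z] ! a < [x, y, z] ! b"
    by blast
  have "strict_mono_on {..<length [x, y, z]} ((!) [i, j, k])"
  proof (rule strict_mono_onI)
    fix a b assume "a \<in> {..<length [x, y, z]}" "b \<in> {..<length [x, y, z]}" "a < b"
    then have "a = 0 \<and> b = 1 \<or> a = 0 \<and> b = 2 \<or> a = 1 \<and> b = 2" by auto
    then show "[i, j, k] ! a < [i, j, k] ! b" using ijk by auto
  qed
  moreover have "\<forall>a<length [x, y, z]. [i, j, k] ! a < length p"
    unfolding all_less_3 using ijk by simp
  ultimately show ?L
    unfolding contains_pattern_def using order by blast
qed

lemma contains_132_iff: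
  "contains_pattern p [1, 3, 2] \<longleftrightarrow>
     (\<exists>i j k. i < j \<and> j < k \<and> k < length p \<and> p ! i < p ! k \<and> p ! k < p ! j)"
  unfolding contains_pattern_3 all_less_3
  by (intro ex_cong1) auto

lemma contains_312_iff:
  "contains_pattern p [3, 1, 2] \<longleftrightarrow>
     (\<exists>i j k. i < j \<and> j < k \<and> k < length p \<and> p ! j < p ! k \<and> p ! k < p ! i)"
  unfolding contains_pattern_3 all_less_3
  by (intro ex_cong1) auto

text \<open>In both patterns the entry in the role of 2 comes last, after a smaller and a larger
  entry whose order decides between 132 and 312. Such an entry is precisely one that is neither a
  new maximum nor a new minimum.\<close>

lemma avoids_132_312_iff_extremal:
  assumes "distinct p"
  shows "\<not> contains_pattern p [1, 3, 2] \<and> \<not> contains_pattern p [3, 1, 2] \<longleftrightarrow> extremal {} p"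
proof
  assume avoids: "\<not> contains_pattern p [1, 3, 2] \<and> \<not> contains_pattern p [3, 1, 2]"
  show "extremal {} p"
    unfolding extremal_iff_nth
  proof (intro allI impI, rule ccontr)
    fix k assume k: "k < length p"
      and "\<not> ((\<forall>i<k. p ! i < p ! k) \<or> (\<forall>i<k. p ! k < p ! i))"
    then obtain i j where ij: "i < k" "j < k" "p ! i \<le> p ! k" "p ! k \<le> p ! j"
      by (auto simp: not_less)
    \<comment> \<open>Distinctness makes the weak inequalities obtained by negation strict.\<close>
    moreover have "p ! i \<noteq> p ! k" "p ! k \<noteq> p ! j"
      using ij k assms by (auto simp: nth_eq_iff_index_eq)
    ultimately have "p ! i < p ! k" "p ! k < p ! j" by auto
    moreover from this have "i < j \<or> j < i"
      by (metis less_asym linorder_neqE_nat)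
    ultimately show False
      using avoids ij k unfolding contains_132_iff contains_312_iff by blast
  qed
next
  assume extremal: "extremal {} p"
  have "\<not> (p ! i < p ! k \<and> p ! k < p ! j)" if "i < k" "j < k" "k < length p" for i j k
    using extremal that unfolding extremal_iff_nth by (meson less_asym)
  then show "\<not> contains_pattern p [1, 3, 2] \<and> \<not> contains_pattern p [3, 1, 2]"
    unfolding contains_132_iff contains_312_iff by (meson less_trans)
qed

section \<open>Decomposition at the maximum: sorting and descents\<close>

lemma split_at_max:
  assumes "distinct p" and "p \<noteq> []"
  obtains L m R where "p = L @ m # R" and "\<forall>x\<in>set L \<union> set R. x < (m :: nat)"
proof -
  have "Max (set p) \<in> set p" using assms by simp
  then obtain L R where p: "p = L @ Max (set p) # R" by (meson split_list)
  have max: "x < Max (set p)" if "x \<in> set L \<union> set R" for x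
  proof -
    have "x \<in> set p" using that by (subst p) auto
    then have "x \<le> Max (set p)" by simp
    moreover have "distinct (L @ Max (set p) # R)" using assms(1) p by simp
    then have "x \<noteq> Max (set p)" using that by auto
    ultimately show ?thesis by simp
  qed
  with p that show thesis by blast
qed

text \<open>Induction along the recursion of \<open>stack_sort\<close>; distinctness makes the
  maximum exceed every other entry.\<close>

lemma max_induct [consumes 1, case_names Nil LmR]:
  assumes "distinct p"
    and "P []"
    and "\<And>L m R. \<lbrakk>distinct (L @ m # R); \<forall>x\<in>set L \<union> set R. x < (m :: nat); P L; P R\<rbrakk>
           \<Longrightarrow> P (L @ m # R)"
  shows "P p"
  using assms(1)
proof (induction "length p" arbitrary: p rule: less_induct)
  case less
  show ?case
  proof (cases "p = []")
    case False
    with less.prems obtain L m R where p: "p = L @ m # R"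
      and m: "\<forall>x\<in>set L \<union> set R. x < m"
      by (rule split_at_max) blast
    have dist: "distinct (L @ m # R)" using less.prems p by simp
    moreover have "P L" by (rule less.hyps) (use dist p in auto)
    moreover have "P R" by (rule less.hyps) (use dist p in auto)
    ultimately show ?thesis unfolding p using m by (intro assms(3))
  qed (simp add: assms(2))
qed

lemma stack_sort_split:
  assumes "\<forall>x\<in>set L \<union> set R. x < m"
  shows "stack_sort (L @ m # R) = stack_sort L @ stack_sort R @ [m]"
  using assms by (intro stack_sort_LmR) blast

lemma set_stack_sort: "distinct p \<Longrightarrow> set (stack_sort p) = set p"
proof (induction p rule: max_induct)
  case (LmR L m R)
  then show ?case by (simp add: stack_sort_split[OF LmR(2)])
qed (simp add: stack_sort_Nil)

lemma distinct_stack_sort: "distinct p \<Longrightarrow> distinct (stack_sort p)"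
proof (induction p rule: max_induct)
  case (LmR L m R)
  then show ?case by (simp add: stack_sort_split[OF LmR(2)] set_stack_sort)
qed (simp add: stack_sort_Nil)

lemma stack_sort_eq_Nil_iff: "distinct p \<Longrightarrow> stack_sort p = [] \<longleftrightarrow> p = []"
  using set_stack_sort[of p] by (metis set_empty)

text \<open>Sorting depends only on the relative order of the entries, since \<open>h\<close> keeps
  the maximum in its place. This allows the two parts of a permutation to be renumbered.\<close>

lemma stack_sort_map:
  assumes "distinct p" and "strict_mono_on (set p) h"
  shows "stack_sort (map h p) = map h (stack_sort p)"
  using assms
proof (induction p rule: max_induct)
  case (LmR L m R)
  have "strict_mono_on (set L) h" "strict_mono_on (set R) h"
    using LmR.prems by (auto intro: monotone_on_subset)
  moreover have "h x < h m" if "x \<in> set L \<union> set R" for x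
    using that LmR(2) by (intro strict_mono_onD[OF LmR.prems]) auto
  then have "\<forall>y\<in>set (map h L) \<union> set (map h R). y < h m" by auto
  note stack_sort_split[OF this]
  ultimately show ?case
    using LmR.IH by (simp add: stack_sort_split[OF LmR(2)])
qed (simp add: stack_sort_Nil)

lemma descents_Nil: "descents [] = {}"
  by (simp add: descents_def)

lemma finite_descents: "finite (descents p)"
  by (rule finite_subset[of _ "{..<length p}"]) (auto simp: descents_def)

lemma descents_Cons:
  "descents (x # p) = (if p \<noteq> [] \<and> hd p < x then {0} else {}) \<union> Suc ` descents p"
proof (rule set_eqI)
  fix i
  show "i \<in> descents (x # p) \<longleftrightarrow>
    i \<in> (if p \<noteq> [] \<and> hd p < x then {0} else {}) \<union> Suc ` descents p"
    by (cases i) (auto simp: descents_def hd_conv_nth)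
qed

lemma card_descents_Cons:
  "card (descents (x # p)) = (if p \<noteq> [] \<and> hd p < x then 1 else 0) + card (descents p)"
  unfolding descents_Cons
  by (subst card_Un_disjoint) (auto simp: finite_descents card_image)

text \<open>The step up to \<open>m\<close> is an ascent and the step down from it a descent,
  present only if something follows. All other descents lie within \<open>L\<close> or
  \<open>R\<close>.\<close>

lemma card_descents_LmR:
  assumes "\<forall>x\<in>set L \<union> set R. x < m"
  shows "card (descents (L @ m # R)) =
    card (descents L) + card (descents R) + (if R = [] then 0 else 1)"
  using assms
proof (induction L)
  case Nil
  then show ?case by (auto simp: card_descents_Cons descents_Nil)
next
  case (Cons x L)
  have "x < m" using Cons.prems by simp
  moreover have "card (descents (L @ m # R)) =
    card (descents L) + card (descents R) + (if R = [] then 0 else 1)"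
    using Cons by simp
  ultimately show ?case
    by (cases L) (simp_all add: card_descents_Cons)
qed

lemma card_descents_map:
  assumes "strict_mono_on (set p) h"
  shows "card (descents (map h p)) = card (descents p)"
  using assms
proof (induction p)
  case (Cons x p)
  have "strict_mono_on (set p) h"
    using Cons.prems by (auto intro: monotone_on_subset)
  moreover have "h (hd p) < h x \<longleftrightarrow> hd p < x" if "p \<noteq> []"
    using that Cons.prems by (intro strict_mono_on_less[of "set (x # p)"]) auto
  ultimately show ?case
    using Cons.IH by (cases "p = []") (auto simp: card_descents_Cons hd_map)
qed (simp add: descents_Nil)

section \<open>From trees to permutations\<close>

text \<open>A renumbering that leaves the values \<open>j + 1\<close> to \<open>j + a\<close> free
  for the entries of a left subtree.\<close>

definition make_gap :: "nat \<Rightarrow> nat \<Rightarrow> nat \<Rightarrow> nat" where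
  "make_gap j a i = (if i \<le> j then i else i + a)"

lemma strict_mono_on_make_gap: "strict_mono_on A (make_gap j a)"
  by (auto simp: strict_mono_on_def make_gap_def)

lemma inj_make_gap: "inj (make_gap j a)"
  by (auto simp: inj_def make_gap_def split: if_splits)

lemma make_gap_image:
  assumes "j \<le> b"
  shows "make_gap j a ` {1..b} = {1..j} \<union> {j + a + 1..b + a}"
proof
  show "{1..j} \<union> {j + a + 1..b + a} \<subseteq> make_gap j a ` {1..b}"
  proof
    fix x assume "x \<in> {1..j} \<union> {j + a + 1..b + a}"
    with assms have "x = make_gap j a (if x \<le> j then x else x - a)"
      "(if x \<le> j then x else x - a) \<in> {1..b}"
      by (auto simp: make_gap_def)
    then show "x \<in> make_gap j a ` {1..b}" by blast
  qed
qed (use assms in \<open>auto simp: make_gap_def split: if_splits\<close>)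

lemma strict_mono_on_add: "strict_mono_on A (\<lambda>i. i + (j :: nat))"
  by (auto simp: strict_mono_on_def)

lemma image_add: "(\<lambda>i. i + j) ` {1..a} = {j + 1..j + (a :: nat)}"
  by (simp add: image_add_atLeastAtMost' add.commute)

text \<open>The number of entries of \<open>q\<close> lying below those of the left subtree.\<close>

fun gap_position :: "zo_label \<Rightarrow> nat list \<Rightarrow> nat" where
  "gap_position Label0 q = hd (stack_sort q)"
| "gap_position Label1 q = hd (stack_sort q) - 1"

text \<open>Let \<open>f\<close> be the first entry of the sorted right part. \<open>Label0\<close>
  opens the gap after \<open>f\<close>, so the left block lies just above it; \<open>Label1\<close>
  opens the gap before \<open>f\<close>, which is itself shifted up, so the block lies just below
  it.\<close>

primrec tree_perm :: "zo_tree \<Rightarrow> nat list" where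
  "tree_perm Leaf = [1]"
| "tree_perm (Only_Left l) = tree_perm l @ [vertices l + 1]"
| "tree_perm (Only_Right r) = (vertices r + 1) # tree_perm r"
| "tree_perm (Both c l r) =
     map (\<lambda>i. i + gap_position c (tree_perm r)) (tree_perm l)
     @ (vertices l + vertices r + 1)
     # map (make_gap (gap_position c (tree_perm r)) (vertices l)) (tree_perm r)"

lemma length_tree_perm: "length (tree_perm t) = vertices t"
  by (induction t) auto

lemma vertices_pos: "vertices t > 0"
  by (cases t) auto

lemma tree_perm_not_Nil: "tree_perm t \<noteq> []"
  by (cases t) auto

lemma hd_stack_sort_mem: "distinct q \<Longrightarrow> q \<noteq> [] \<Longrightarrow> hd (stack_sort q) \<in> set q"
  by (metis hd_in_set set_stack_sort stack_sort_eq_Nil_iff)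

lemma gap_position_le:
  assumes "distinct q" and "q \<noteq> []" and "set q = {1..b}"
  shows "gap_position c q \<le> b"
  using hd_stack_sort_mem[OF assms(1,2)] assms(3) by (cases c) auto

text \<open>The shifted values of the left subtree fill exactly the gap made among those of the
  right one, because the gap position is at most \<open>vertices r\<close>.\<close>

lemma distinct_set_tree_perm: "distinct (tree_perm t) \<and> set (tree_perm t) = {1..vertices t}"
proof (induction t)
  case (Both c l r)
  let ?j = "gap_position c (tree_perm r)"
  have j: "?j \<le> vertices r"
    using Both by (intro gap_position_le) (auto simp: tree_perm_not_Nil)
  let ?L = "map (\<lambda>i. i + ?j) (tree_perm l)"
  let ?R = "map (make_gap ?j (vertices l)) (tree_perm r)"
  let ?m = "vertices l + vertices r + 1"
  have set_L: "set ?L = {?j + 1..?j + vertices l}"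
    using Both by (simp only: set_map image_add)
  have set_R: "set ?R = {1..?j} \<union> {?j + vertices l + 1..vertices r + vertices l}"
    using Both make_gap_image[OF j] by (simp only: set_map)
  have "distinct ?L" "distinct ?R"
    using Both by (simp_all add: distinct_map inj_on_def inj_make_gap[THEN injD])
  then have "distinct (?L @ ?m # ?R)"
    unfolding distinct_append distinct.simps list.set set_L set_R using j by auto
  moreover have "set (?L @ ?m # ?R) = {1..?m}"
    unfolding set_append list.set set_L set_R using j by auto
  ultimately show ?case
    unfolding tree_perm.simps vertices.simps by (simp only: ac_simps simp_thms)
next
  case (Only_Left l)
  moreover have "{1..vertices l} \<union> {vertices l + 1} = {1..vertices l + 1}" by auto
  ultimately show ?case by simp
next
  case (Only_Right r)
  moreover have "insert (vertices r + 1) {1..vertices r} = {1..vertices r + 1}" by auto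
  ultimately show ?case by simp
qed simp

lemmas distinct_tree_perm = distinct_set_tree_perm[THEN conjunct1]
lemmas set_tree_perm = distinct_set_tree_perm[THEN conjunct2]

lemma max_middle:
  assumes "distinct (L @ m # R)" and "set (L @ m # R) = {1..m :: nat}"
  shows "\<forall>x\<in>set L \<union> set R. x < m"
proof
  fix x assume x: "x \<in> set L \<union> set R"
  then have "x \<noteq> m" using assms(1) by auto
  moreover have "x \<in> {1..m}" using x assms(2) by auto
  ultimately show "x < m" by simp
qed

lemma tree_perm_Both_less:
  "\<forall>x\<in>set (map (\<lambda>i. i + gap_position c (tree_perm r)) (tree_perm l)) \<union>
      set (map (make_gap (gap_position c (tree_perm r)) (vertices l)) (tree_perm r)).
     x < vertices l + vertices r + 1"
  using distinct_set_tree_perm[of "Both c l r"]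
  unfolding tree_perm.simps by (intro max_middle) simp_all

text \<open>The maximum creates a descent exactly when the root has a right edge, and renumbering
  preserves the descents of the parts.\<close>

lemma card_descents_tree_perm: "card (descents (tree_perm t)) = right_edges t"
proof (induction t)
  case (Both c l r)
  then show ?case
    unfolding tree_perm.simps card_descents_LmR[OF tree_perm_Both_less]
    by (simp add: card_descents_map strict_mono_on_make_gap strict_mono_on_add tree_perm_not_Nil)
next
  case (Only_Left l)
  then show ?case
    using card_descents_LmR[of "tree_perm l" "[]" "vertices l + 1"]
    by (simp add: set_tree_perm descents_Nil)
next
  case (Only_Right r)
  then show ?case
    using card_descents_LmR[of "[]" "tree_perm r" "vertices r + 1"]
    by (simp add: set_tree_perm descents_Nil tree_perm_not_Nil)
qed (simp add: descents_def)

section \<open>Sorted images of tree permutations\<close>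

text \<open>The maximum comes last and always passes the test; the entries that precede
  \<open>s(R)\<close> are those of \<open>L\<close>.\<close>

lemma extremal_stack_sort_LmR:
  assumes "distinct (L @ m # R)" and "\<forall>x\<in>set L \<union> set R. x < m"
  shows "extremal {} (stack_sort (L @ m # R)) \<longleftrightarrow>
    extremal {} (stack_sort L) \<and> extremal (set L) (stack_sort R)"
  using assms(1)
  by (auto simp: stack_sort_split[OF assms(2)] extremal_append set_stack_sort assms(2))

lemma extremal_stack_sort_map:
  assumes "distinct p" and "strict_mono_on (set p) h"
  shows "extremal {} (stack_sort (map h p)) \<longleftrightarrow> extremal {} (stack_sort p)"
  using extremal_map[of "{}" "stack_sort p" h] assms
  by (simp add: stack_sort_map set_stack_sort)

text \<open>For two children, the left block is adjacent in value to the first entry of the sorted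
  right part. No later entry falls between them, so extremality against that first entry extends to
  the block.\<close>

lemma extremal_tree_perm: "extremal {} (stack_sort (tree_perm t))"
proof (induction t)
  case Leaf
  show ?case using stack_sort_LmR[of "[]" "[]" 1] by (simp add: stack_sort_Nil)
next
  case (Only_Left l)
  then show ?case
    using extremal_stack_sort_LmR[of "tree_perm l" "vertices l + 1" "[]"]
    by (simp add: set_tree_perm distinct_tree_perm stack_sort_Nil)
next
  case (Only_Right r)
  then show ?case
    using extremal_stack_sort_LmR[of "[]" "vertices r + 1" "tree_perm r"]
    by (simp add: set_tree_perm distinct_tree_perm stack_sort_Nil)
next
  case (Both c l r)
  let ?q = "tree_perm r" and ?a = "vertices l"
  let ?j = "gap_position c ?q"
  let ?h = "make_gap ?j ?a"
  let ?S = "{?j + 1..?j + ?a}"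
  have setL: "set (map (\<lambda>i. i + ?j) (tree_perm l)) = ?S"
    by (simp only: set_map image_add set_tree_perm)
  obtain f q' where q: "stack_sort ?q = f # q'"
    by (metis distinct_tree_perm list.exhaust stack_sort_eq_Nil_iff tree_perm_not_Nil)
  \<comment> \<open>Values start at 1, so the subtraction in \<open>gap_position\<close> is never
    truncated.\<close>
  have "f \<ge> 1"
    using hd_stack_sort_mem[of ?q] q by (simp add: distinct_tree_perm tree_perm_not_Nil set_tree_perm)
  then have c: "c = Label0 \<and> ?j = f \<or> c = Label1 \<and> ?j = f - 1"
    using q by (cases c) auto
  have "extremal {f} q'" using Both(2) q by simp
  then have "extremal (?h ` {f}) (map ?h q')"
    by (subst extremal_map) (auto intro: strict_mono_on_make_gap)
  then have "extremal ({} \<union> {?h f}) (map ?h q')" by simp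
  \<comment> \<open>A later entry differs from \<open>?h f\<close> and avoids the gap, so it lies on
    one side of \<open>?h f\<close> and the whole block together.\<close>
  then have "extremal ({} \<union> insert (?h f) ?S) (map ?h q')"
  proof (rule extremal_enlarge)
    fix y assume "y \<in> set (map ?h q')"
    then obtain x where x: "x \<in> set q'" "y = ?h x" by auto
    moreover have "x \<noteq> f"
      using distinct_stack_sort[OF distinct_tree_perm[of r]] x q by auto
    ultimately show "(\<forall>z\<in>insert (?h f) ?S. z < y) \<or> (\<forall>z\<in>insert (?h f) ?S. y < z)"
      using c \<open>f \<ge> 1\<close> by (auto simp: make_gap_def)
  qed auto
  moreover have "(\<forall>z\<in>?S. z < ?h f) \<or> (\<forall>z\<in>?S. ?h f < z)"
    using c \<open>f \<ge> 1\<close> by (auto simp: make_gap_def)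
  ultimately have "extremal ?S (stack_sort (map ?h ?q))"
    by (simp add: stack_sort_map distinct_tree_perm strict_mono_on_make_gap q)
  moreover have "extremal {} (stack_sort (map (\<lambda>i. i + ?j) (tree_perm l)))"
    using Both(1) by (simp add: extremal_stack_sort_map distinct_tree_perm strict_mono_on_add)
  ultimately show ?case
    using distinct_tree_perm[of "Both c l r"]
    unfolding tree_perm.simps
    by (simp only: extremal_stack_sort_LmR[OF _ tree_perm_Both_less] setL)
qed

section \<open>Injectivity\<close>

text \<open>The number \<open>vertices t\<close> is the maximum and also the length of
  \<open>tree_perm t\<close>, so both parts depend on the permutation alone and agree for trees with
  equal permutations.\<close>

definition left_part :: "zo_tree \<Rightarrow> nat list" where
  "left_part t = takeWhile (\<lambda>x. x \<noteq> vertices t) (tree_perm t)"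

definition right_part :: "zo_tree \<Rightarrow> nat list" where
  "right_part t = tl (dropWhile (\<lambda>x. x \<noteq> vertices t) (tree_perm t))"

lemma parts_eqI:
  assumes "tree_perm t = L @ vertices t # R"
  shows "left_part t = L \<and> right_part t = R"
proof -
  have "vertices t \<notin> set L" using distinct_tree_perm[of t] assms by auto
  then show ?thesis
    unfolding left_part_def right_part_def assms
    by (auto simp: takeWhile_append dropWhile_append)
qed

lemma parts_simps [simp]:
  "left_part Leaf = []" "right_part Leaf = []"
  "left_part (Only_Left l) = tree_perm l" "right_part (Only_Left l) = []"
  "left_part (Only_Right r) = []" "right_part (Only_Right r) = tree_perm r"
  "left_part (Both c l r) = map (\<lambda>i. i + gap_position c (tree_perm r)) (tree_perm l)"
  "right_part (Both c l r) = map (make_gap (gap_position c (tree_perm r)) (vertices l)) (tree_perm r)"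
  using parts_eqI[of Leaf "[]" "[]"] parts_eqI[of "Only_Left l" "tree_perm l" "[]"]
    parts_eqI[of "Only_Right r" "[]" "tree_perm r"] parts_eqI[of "Both c l r"]
  by simp_all

lemma gap_position_inj:
  assumes "gap_position c q = gap_position c' q" and "hd (stack_sort q) > 0"
  shows "c = c'"
  using assms by (cases c; cases c') auto

lemma inj_tree_perm: "inj tree_perm"
proof -
  have "tree_perm t = tree_perm u \<Longrightarrow> t = u" for t u
  proof (induction t arbitrary: u)
    case Leaf
    then have "left_part Leaf = left_part u" "right_part Leaf = right_part u"
      by (metis left_part_def right_part_def length_tree_perm)+
    \<comment> \<open>Which of the two parts are empty determines the constructor at the root of
      \<open>u\<close>.\<close>
    then show ?case by (cases u) (auto simp: tree_perm_not_Nil tree_perm_not_Nil[symmetric])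
  next
    case (Only_Left l)
    then have "left_part (Only_Left l) = left_part u" "right_part (Only_Left l) = right_part u"
      by (metis left_part_def right_part_def length_tree_perm)+
    then show ?case using Only_Left.IH by (cases u) (auto simp: tree_perm_not_Nil tree_perm_not_Nil[symmetric])
  next
    case (Only_Right r)
    then have "left_part (Only_Right r) = left_part u" "right_part (Only_Right r) = right_part u"
      by (metis left_part_def right_part_def length_tree_perm)+
    then show ?case using Only_Right.IH by (cases u) (auto simp: tree_perm_not_Nil tree_perm_not_Nil[symmetric])
  next
    case (Both c l r)
    then have parts: "left_part (Both c l r) = left_part u" "right_part (Both c l r) = right_part u"
      by (metis left_part_def right_part_def length_tree_perm)+
    then obtain c' l' r' where u: "u = Both c' l' r'"
      by (cases u) (auto simp: tree_perm_not_Nil tree_perm_not_Nil[symmetric])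
    let ?j = "gap_position c (tree_perm r)" and ?j' = "gap_position c' (tree_perm r')"
    have L: "map (\<lambda>i. i + ?j) (tree_perm l) = map (\<lambda>i. i + ?j') (tree_perm l')"
      and R: "map (make_gap ?j (vertices l)) (tree_perm r) =
        map (make_gap ?j' (vertices l')) (tree_perm r')"
      using parts u by simp_all
    have "vertices l = vertices l'"
      using arg_cong[OF L, of length] by (simp add: length_tree_perm)
    \<comment> \<open>The values of the left block form a non-empty interval, whose lower end gives
      the gap position.\<close>
    moreover have "{?j + 1..?j + vertices l} = {?j' + 1..?j' + vertices l'}"
      using arg_cong[OF L, of set] by (simp only: set_map set_tree_perm image_add)
    ultimately have j: "?j = ?j'"
      using vertices_pos[of l] by (simp add: Icc_eq_Icc)
    have "tree_perm l = tree_perm l'"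
      using L unfolding j by (simp add: inj_map_eq_map inj_def)
    moreover have "tree_perm r = tree_perm r'"
      using R unfolding j \<open>vertices l = vertices l'\<close>
      by (simp only: inj_map_eq_map[OF inj_make_gap])
    ultimately have "l = l'" "r = r'" using Both.IH by blast+
    \<comment> \<open>The label comes last: the candidate gap positions \<open>f\<close> and
      \<open>f - 1\<close> differ as \<open>f\<close> is positive.\<close>
    moreover have "hd (stack_sort (tree_perm r)) > 0"
      using hd_stack_sort_mem[of "tree_perm r"]
      by (simp add: distinct_tree_perm tree_perm_not_Nil set_tree_perm)
    ultimately show ?case
      using j gap_position_inj u by blast
  qed
  then show ?thesis by (simp add: inj_def)
qed

section \<open>Surjectivity\<close>

text \<open>Strong induction on the length: \<open>L\<close> and \<open>R\<close> are renumbered to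
  permutations of initial segments, which come from trees by induction. The label is read off from
  the side of \<open>f\<close> on which the values of \<open>L\<close> lie.\<close>

lemma tree_perm_surj:
  assumes "distinct p" and "set p = {1..length p}" and "p \<noteq> []" and "extremal {} (stack_sort p)"
  shows "p \<in> range tree_perm"
  using assms
proof (induction "length p" arbitrary: p rule: less_induct)
  case less
  obtain L m R where p: "p = L @ m # R" and less_m: "\<forall>x\<in>set L \<union> set R. x < m"
    using less.prems(1,3) by (rule split_at_max)
  let ?a = "length L" and ?b = "length R"
  have dist: "distinct (L @ m # R)" using less.prems(1) p by simp
  have len: "length p = ?a + ?b + 1" using p by simp
  have set_p: "set L \<union> {m} \<union> set R = {1..?a + ?b + 1}"
    using less.prems(2) unfolding len by (simp add: p)
  have m: "m = ?a + ?b + 1"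
  proof (rule antisym)
    show "m \<le> ?a + ?b + 1" using set_p by auto
    have "?a + ?b + 1 \<in> set L \<union> {m} \<union> set R" unfolding set_p by simp
    then show "?a + ?b + 1 \<le> m" using less_m by (auto intro: less_imp_le)
  qed
  have "m \<notin> set L \<union> set R" using less_m by blast
  then have "set L \<union> set R = (set L \<union> {m} \<union> set R) - {m}" by blast
  also have "\<dots> = {1..?a + ?b}" unfolding set_p unfolding m by auto
  finally have set_LR: "set L \<union> set R = {1..?a + ?b}" .
  have ext_L: "extremal {} (stack_sort L)" and ext_R: "extremal (set L) (stack_sort R)"
    using extremal_stack_sort_LmR[OF dist less_m] less.prems(4) p by auto
  consider "L = []" "R = []" | "L \<noteq> []" "R = []" | "L = []" "R \<noteq> []" | "L \<noteq> []" "R \<noteq> []"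
    by blast
  then show ?case
  proof cases
    case 1
    then have "p = tree_perm Leaf" using p m by simp
    then show ?thesis by blast
  next
    case 2
    then obtain l where "L = tree_perm l"
      using less.hyps[of L] p dist set_LR ext_L by auto
    then have "p = tree_perm (Only_Left l)"
      using 2 p m by (simp add: length_tree_perm)
    then show ?thesis by blast
  next
    case 3
    then obtain r where "R = tree_perm r"
      using less.hyps[of R] p dist set_LR ext_R by auto
    then have "p = tree_perm (Only_Right r)"
      using 3 p m by (simp add: length_tree_perm)
    then show ?thesis by blast
  next
    case 4
    obtain f q where q: "stack_sort R = f # q"
      using 4 dist by (metis distinct.simps(2) distinct_append list.exhaust stack_sort_eq_Nil_iff)
    have set_R: "set R = insert f (set q)"
      using q dist set_stack_sort[of R] by simp
    have R_extreme: "(\<forall>y\<in>set L. y < x) \<or> (\<forall>y\<in>set L. x < y)" if "x \<in> set R" for x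
      using extremal_member[OF ext_R] that dist by (simp add: set_stack_sort)
    have q_extreme: "(\<forall>y\<in>insert f (set L). y < x) \<or> (\<forall>y\<in>insert f (set L). x < y)"
      if "x \<in> set q" for x
      using extremal_member[of "insert f (set L)" q] ext_R q that by simp
    \<comment> \<open>The values of \<open>L\<close> turn out to be \<open>j + 1\<close> to
      \<open>j + ?a\<close>, so \<open>j\<close> is the gap position to be realised.\<close>
    define j where "j = Min (set L) - 1"
    have Min: "Min (set L) \<in> set L" and Max: "Max (set L) \<in> set L" using 4 by simp_all
    then have "Min (set L) \<ge> 1" using set_LR by fastforce
    \<comment> \<open>A value between the extremes of \<open>L\<close> cannot belong to
      \<open>R\<close>, each of whose entries lies above or below all of \<open>L\<close>.\<close>
    have "set L = {Min (set L)..Max (set L)}"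
    proof
      show "{Min (set L)..Max (set L)} \<subseteq> set L"
      proof
        fix x assume x: "x \<in> {Min (set L)..Max (set L)}"
        moreover have "Max (set L) \<le> ?a + ?b" using Max set_LR by fastforce
        ultimately have "x \<in> set L \<union> set R" unfolding set_LR using \<open>Min (set L) \<ge> 1\<close> by simp
        moreover have "x \<notin> set R"
          using R_extreme[of x] Min Max x by (meson atLeastAtMost_iff leD)
        ultimately show "x \<in> set L" by simp
      qed
    qed auto
    moreover have "card (set L) = ?a" using dist distinct_card by auto
    moreover have "card {Min (set L)..Max (set L)} = Max (set L) + 1 - Min (set L)" by simp
    ultimately have "Max (set L) + 1 - Min (set L) = ?a" by metis
    moreover have a_pos: "1 \<le> ?a" using 4 by (simp add: Suc_le_eq)
    ultimately have "Max (set L) = j + ?a"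
      using \<open>Min (set L) \<ge> 1\<close> unfolding j_def by linarith
    then have set_L: "set L = {j + 1..j + ?a}"
      using \<open>set L = {Min (set L)..Max (set L)}\<close> \<open>Min (set L) \<ge> 1\<close> unfolding j_def by simp
    have j_le: "j \<le> ?b"
    proof -
      have "j + ?a \<in> set L \<union> set R" unfolding set_L using a_pos by simp
      then show ?thesis unfolding set_LR by simp
    qed

    have ends: "j + 1 \<in> set L" "j + ?a \<in> set L" unfolding set_L using a_pos by auto

    \<comment> \<open>All entries of \<open>L\<close> exceed \<open>j\<close>, so this subtraction
      is exact and is undone by adding \<open>j\<close>.\<close>
    define L' where "L' = map (\<lambda>i. i - j) L"
    have L: "L = map (\<lambda>i. i + j) L'"
      unfolding L'_def map_map by (rule map_idI[symmetric]) (auto simp: set_L)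
    then have "distinct L'" using dist by (auto simp: distinct_map)
    moreover have "set L' = {1..length L'}"
    proof -
      have "(\<lambda>i. i + j) ` set L' = (\<lambda>i. i + j) ` {1..length L'}"
        using set_L unfolding image_add L by simp
      then show ?thesis by (simp only: inj_image_eq_iff[OF inj_on_add'])
    qed
    moreover have "extremal {} (stack_sort L')"
      using ext_L \<open>distinct L'\<close> unfolding L
      by (simp only: extremal_stack_sort_map strict_mono_on_add)
    moreover have "length L' < length p" "L' \<noteq> []" using 4 len by (simp_all add: L'_def)
    ultimately obtain l where l: "L' = tree_perm l" using less.hyps[of L'] by auto

    let ?g = "make_gap j ?a"
    have "set R = (set L \<union> set R) - set L" using dist by auto
    also have "\<dots> = {1..j} \<union> {j + ?a + 1..?b + ?a}"
      unfolding set_LR unfolding set_L using j_le by auto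
    finally have set_R': "set R = {1..j} \<union> {j + ?a + 1..?b + ?a}" .
    then have R_image: "set R = ?g ` {1..?b}" by (simp only: make_gap_image[OF j_le])
    \<comment> \<open>Each entry of \<open>R\<close> lies in the image of \<open>?g\<close>, so
      applying \<open>inv ?g\<close> and then \<open>?g\<close> restores it.\<close>
    define R' where "R' = map (inv ?g) R"
    have R: "R = map ?g R'"
      unfolding R'_def map_map
      by (rule map_idI[symmetric]) (use R_image in \<open>auto simp: inv_f_f[OF inj_make_gap]\<close>)
    then have "distinct R'" using dist by (auto simp: distinct_map)
    moreover have "set R' = {1..length R'}"
      using R_image by (simp add: R'_def image_inv_f_f[OF inj_make_gap])
    moreover have "extremal {} (stack_sort (map ?g R'))"
      using extremal_mono[OF ext_R empty_subsetI] by (simp only: R[symmetric])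
    then have "extremal {} (stack_sort R')"
      using \<open>distinct R'\<close> by (simp only: extremal_stack_sort_map strict_mono_on_make_gap)
    moreover have "length R' < length p" "R' \<noteq> []" using 4 len by (simp_all add: R'_def)
    ultimately obtain r where r: "R' = tree_perm r" using less.hyps[of R'] by auto

    have "stack_sort R = map ?g (stack_sort R')"
      by (subst R) (rule stack_sort_map[OF \<open>distinct R'\<close> strict_mono_on_make_gap])
    then have f: "f = ?g (hd (stack_sort R'))" using q by auto
    have "\<exists>c. gap_position c R' = j"
    proof (cases "f \<le> j")
      case True
      \<comment> \<open>Otherwise \<open>j\<close> would follow \<open>f\<close> in the sorted right
        part, above \<open>f\<close> but below the values of \<open>L\<close>.\<close>
      have "f = j"
      proof (rule ccontr)
        assume "f \<noteq> j"
        then have "j \<in> set q" using True set_R set_R' by auto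
        from q_extreme[OF this] have "j < f \<or> j + 1 < j"
          using \<open>f \<noteq> j\<close> ends(1) by blast
        then show False using True by simp
      qed
      then have "gap_position Label0 R' = j"
        using f 4 by (auto simp: make_gap_def split: if_splits)
      then show ?thesis ..
    next
      case False
      moreover have "f \<in> set R" using set_R by simp
      ultimately have "j + ?a + 1 \<le> f" "f \<le> ?a + ?b" unfolding set_R' by auto
      \<comment> \<open>Otherwise \<open>j + ?a + 1\<close> would follow \<open>f\<close> in the
        sorted right part, below \<open>f\<close> but above the values of \<open>L\<close>.\<close>
      have "f = j + ?a + 1"
      proof (rule ccontr)
        assume "f \<noteq> j + ?a + 1"
        moreover have "j + ?a + 1 \<in> set R"
          using \<open>j + ?a + 1 \<le> f\<close> \<open>f \<le> ?a + ?b\<close> by (simp add: set_R')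
        ultimately have "j + ?a + 1 \<in> set q" using set_R by auto
        from q_extreme[OF this] have "f < j + ?a + 1 \<or> j + ?a + 1 < j + ?a"
          using ends(2) by blast
        then show False using \<open>j + ?a + 1 \<le> f\<close> by simp
      qed
      \<comment> \<open>Here \<open>f\<close> is the image of \<open>j + 1\<close> under
        \<open>?g\<close>, and \<open>Label1\<close> subtracts 1.\<close>
      then have "gap_position Label1 R' = j"
        using f by (auto simp: make_gap_def split: if_splits)
      then show ?thesis ..
    qed
    then obtain c where "gap_position c (tree_perm r) = j" using r by blast
    moreover have "vertices l = ?a" "vertices r = ?b"
      using l r L R by (metis length_map length_tree_perm)+
    ultimately have "p = tree_perm (Both c l r)"
      using p m l r L R by simp
    then show ?thesis by blast
  qed
qed

section \<open>The bijection and the count\<close>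

theorem proposition2p2:
  fixes n k :: nat
  assumes "n \<ge> 1" and "k \<ge> 1"
  shows "card {p \<in> stack_sort_preimage_Av n [1, 3, 2] [3, 1, 2]. card (descents p) = k - 1}
         = BoNa n k"
proof -
  \<comment> \<open>Sorting keeps the set of entries and distinctness, so only the avoidance
    condition remains, in the form \<open>extremal {}\<close>.\<close>
  have preimage: "stack_sort_preimage_Av n [1, 3, 2] [3, 1, 2] =
    {p. distinct p \<and> set p = {1..n} \<and> extremal {} (stack_sort p)}"
  proof (rule set_eqI)
    fix p
    show "p \<in> stack_sort_preimage_Av n [1, 3, 2] [3, 1, 2] \<longleftrightarrow>
      p \<in> {p. distinct p \<and> set p = {1..n} \<and> extremal {} (stack_sort p)}"
    proof (cases "distinct p")
      case True
      then show ?thesis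
        unfolding stack_sort_preimage_Av_def Av_def permutations_of_set_def mem_Collect_eq
          avoids_132_312_iff_extremal[OF distinct_stack_sort[OF True]]
        by (simp add: set_stack_sort distinct_stack_sort)
    qed (simp add: stack_sort_preimage_Av_def permutations_of_set_def)
  qed
  have "bij_betw tree_perm {t. vertices t = n \<and> right_edges t = k - 1}
    {p \<in> stack_sort_preimage_Av n [1, 3, 2] [3, 1, 2]. card (descents p) = k - 1}"
    unfolding preimage
  proof (rule bij_betw_imageI)
    show "inj_on tree_perm {t. vertices t = n \<and> right_edges t = k - 1}"
      using inj_tree_perm by (rule inj_on_subset) simp
    show "tree_perm ` {t. vertices t = n \<and> right_edges t = k - 1} =
      {p \<in> {p. distinct p \<and> set p = {1..n} \<and> extremal {} (stack_sort p)}.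
         card (descents p) = k - 1}" (is "?A = ?B")
    proof
      show "?A \<subseteq> ?B"
        by (auto simp: distinct_tree_perm set_tree_perm extremal_tree_perm card_descents_tree_perm)
      show "?B \<subseteq> ?A"
      proof
        fix p assume p: "p \<in> ?B"
        then have "length p = n" using distinct_card[of p] by simp
        \<comment> \<open>The assumption \<open>n \<ge> 1\<close> excludes the empty list, which
          comes from no tree.\<close>
        with p assms(1) have "p \<in> range tree_perm" by (intro tree_perm_surj) auto
        with p \<open>length p = n\<close> show "p \<in> ?A"
          by (auto simp: card_descents_tree_perm length_tree_perm)
      qed
    qed
  qed
  from bij_betw_same_card[OF this] show ?thesis
    unfolding BoNa_def by (rule sym)
qed

end
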